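(* Let $(M,d)$ be a metric space and let $Y$ be a bounded subset of $M$. Let $\mathcal{N}$ be a $\sigma$-algebra of subsets of $Y$ containing all Borel subsets of $Y$, and let $\nu$ be a measure on $\mathcal{N}$ such that $\nu(B(x,r)\cap Y)<+\infty$ for all $x\in Y$, $r>0$. Let $\upsilon_Y\in]0,+\infty[$, $s\in[0,\upsilon_Y[$, and assume that $Y$ is upper $\upsilon_Y$-Ahlfors regular with respect to $Y$. Let $K\in\mathcal{K}_{s,Y\times Y}$ and let $A[K,\cdot]$ be the integral operator $A[K,\mu](x)\equiv\int_Y K(x,y)\mu(y)\,d\nu(y)$, $x\in Y$, acting on $L^2_\nu(Y)$. If $g\in C^0_b(Y)$ and $\mu\in L^2_\nu(Y)$ satisfies $\mu-A[K,\mu]=g$ $\nu$-a.e. in $Y$, then $\mu\in C^0_b(Y)$ (i.e., $\mu$ has a bounded continuous representative).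
   Context: For $\xi\in M$, $r>0$, $B(\xi,r)=\{\eta\in M: d(\xi,\eta)<r\}$. $Y$ is upper $\upsilon$-Ahlfors regular with respect to $Y$ if there exist $r_0\in]0,+\infty]$, $c_0\in]0,+\infty[$ with $\nu(B(x,r)\cap Y)\leq c_0r^{\upsilon}$ for all $x\in Y$, $r\in]0,r_0[$. For $s\in\mathbb{R}$, $\mathcal{K}_{s,Y\times Y}$ is the set of continuous $K:\{(x,y)\in Y^2: x\neq y\}\to\mathbb{C}$ with $\sup_{x\neq y}|K(x,y)|d(x,y)^s<+\infty$. $C^0_b(Y)$ is the space of bounded continuous complex-valued functions on $Y$. *)

theory Defs
  imports "HOL-Analysis.Analysis"
begin

definition upper_ahlfors_regular ::
    "'a::metric_space measure \<Rightarrow> real \<Rightarrow> 'a set \<Rightarrow> bool" where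
  "upper_ahlfors_regular nu ups Y \<longleftrightarrow>
     (\<exists>r0::ereal. \<exists>c0::real. r0 > 0 \<and> c0 > 0 \<and>
        (\<forall>x\<in>Y. \<forall>r::real. 0 < r \<and> ereal r < r0 \<longrightarrow>
            emeasure nu (ball x r \<inter> Y) \<le> ennreal (c0 * r powr ups)))"

definition kernel_class ::
    "real \<Rightarrow> 'a::metric_space set \<Rightarrow> ('a \<Rightarrow> 'a \<Rightarrow> complex) set" where
  "kernel_class s Y = {K.
     continuous_on {(x, y). x \<in> Y \<and> y \<in> Y \<and> x \<noteq> y} (\<lambda>(x, y). K x y) \<and>
     (\<exists>C. \<forall>x\<in>Y. \<forall>y\<in>Y. x \<noteq> y \<longrightarrow> norm (K x y) * dist x y powr s \<le> C)}"

definition int_op ::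
    "'a measure \<Rightarrow> ('a \<Rightarrow> 'a \<Rightarrow> complex) \<Rightarrow> ('a \<Rightarrow> complex) \<Rightarrow> 'a \<Rightarrow> complex" where
  "int_op nu K mu x = (\<integral>y. K x y * mu y \<partial>nu)"

definition L2 :: "'a measure \<Rightarrow> ('a \<Rightarrow> complex) set" where
  "L2 nu = {f. f \<in> borel_measurable nu \<and> integrable nu (\<lambda>x. (norm (f x))\<^sup>2)}"

end

theory Submission
  imports Defs
begin

text \<open>
  A weakly singular potential of a bounded density is continuous, so it suffices to show that \<open>\<mu>\<close> is
  essentially bounded. Cutting the kernel at a small distance \<open>\<delta>\<close> gives \<open>u \<le> B + C T u\<close> almost
  everywhere for \<open>u = |\<mu>|\<close>, where \<open>T\<close> has kernel \<open>d(x, y) powr - s\<close> restricted to \<open>d(x, y) < \<delta>\<close> and,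
  by Ahlfors regularity, small norm on both \<open>L\<^sup>\<infinity>\<close> and \<open>L\<^sup>1\<close>. Hence \<open>w = max (u - 2 B) 0\<close> satisfies
  \<open>w \<le> C T w\<close>, and integrating yields \<open>\<integral> w \<le> \<integral> w / 2\<close>, i.e. \<open>w = 0\<close>.

  Since \<open>Y\<close> need not be separable, \<open>(x, y) \<mapsto> d(x, y)\<close> need not be measurable for the product
  \<open>\<sigma>\<close>-algebra and Tonelli's theorem is not available for the \<open>L\<^sup>1\<close> bound. Instead the kernel is
  majorised by a sum over dyadic balls, and at each scale \<open>r\<close> a maximal \<open>2 r\<close>-separated set of centres
  of balls of positive measure, which is countable, replaces the outer integration variable.
\<close>

section \<open>Separated nets, countability and dyadic scales\<close>

text \<open>Zorn's lemma applies because two points of the union of a chain already lie in one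
  member. Maximality makes \<open>S\<close> a net: a point at distance at least
  \<open>\<epsilon>\<close> from all of \<open>S\<close> could be added to it.\<close>

lemma maximal_separated_subset:
  fixes P :: "'a::metric_space set"
  assumes "0 < \<epsilon>"
  obtains S where "S \<subseteq> P" "\<And>x y. x \<in> S \<Longrightarrow> y \<in> S \<Longrightarrow> x \<noteq> y \<Longrightarrow> \<epsilon> \<le> dist x y"
    "\<And>x. x \<in> P \<Longrightarrow> \<exists>y\<in>S. dist x y < \<epsilon>"
proof -
  define \<A> where "\<A> = {S. S \<subseteq> P \<and> (\<forall>x\<in>S. \<forall>y\<in>S. x \<noteq> y \<longrightarrow> \<epsilon> \<le> dist x y)}"
  have "\<exists>M\<in>\<A>. \<forall>X\<in>\<A>. M \<subseteq> X \<longrightarrow> X = M"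
  proof (rule subset_Zorn_nonempty)
    show "\<A> \<noteq> {}" by (auto simp: \<A>_def)
    fix \<C> assume "\<C> \<noteq> {}" and ch: "subset.chain \<A> \<C>"
    have sub: "\<C> \<subseteq> \<A>" using ch by (simp add: subset.chain_def)
    have "\<epsilon> \<le> dist x y" if xy: "x \<in> \<Union>\<C>" "y \<in> \<Union>\<C>" "x \<noteq> y" for x y
    proof -
      obtain X Z where XZ: "X \<in> \<C>" "x \<in> X" "Z \<in> \<C>" "y \<in> Z" using xy by blast
      then have "X \<subseteq> Z \<or> Z \<subseteq> X" using ch by (auto simp: subset_chain_def)
      with XZ obtain W where "W \<in> \<C>" "x \<in> W" "y \<in> W" by blast
      with sub xy(3) show ?thesis by (auto simp: \<A>_def)
    qed
    then show "\<Union>\<C> \<in> \<A>" using sub by (auto simp: \<A>_def)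
  qed
  then obtain S where S: "S \<in> \<A>" and max: "\<And>X. X \<in> \<A> \<Longrightarrow> S \<subseteq> X \<Longrightarrow> X = S" by blast
  have "\<exists>y\<in>S. dist x y < \<epsilon>" if "x \<in> P" for x
  proof (rule ccontr)
    assume no: "\<not> ?thesis"
    then have "x \<notin> S" using \<open>0 < \<epsilon>\<close> by force
    from no have "\<forall>y\<in>S. \<epsilon> \<le> dist x y" by force
    then have "insert x S \<in> \<A>" using S that by (auto simp: \<A>_def dist_commute)
    from max[OF this] \<open>x \<notin> S\<close> show False by blast
  qed
  with S show ?thesis unfolding \<A>_def by (intro that[of S]) auto
qed

text \<open>Every finite partial sum of the measures is bounded by the total mass, so the family is
  summable, and a summable real family has only countably many nonzero terms.\<close>

lemma (in finite_measure) countable_disjoint_positive_measure: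
  assumes disj: "disjoint_family_on B S"
    and meas: "\<And>i. i \<in> S \<Longrightarrow> B i \<in> sets M"
    and pos: "\<And>i. i \<in> S \<Longrightarrow> 0 < measure M (B i)"
  shows "countable S"
proof -
  have "(\<lambda>i. measure M (B i)) summable_on S"
  proof (rule nonneg_bdd_above_summable_on)
    show "bdd_above (sum (\<lambda>i. measure M (B i)) ` {F. F \<subseteq> S \<and> finite F})"
    proof (rule bdd_aboveI2)
      fix F assume F: "F \<in> {F. F \<subseteq> S \<and> finite F}"
      then have "(\<Sum>i\<in>F. measure M (B i)) = measure M (\<Union>i\<in>F. B i)"
        using disj meas by (intro finite_measure_finite_Union[symmetric])
          (auto intro: disjoint_family_on_mono)
      also have "\<dots> \<le> measure M (space M)" by (rule bounded_measure)
      finally show "(\<Sum>i\<in>F. measure M (B i)) \<le> measure M (space M)" .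
    qed
  qed simp
  then have "countable {i \<in> S. measure M (B i) \<noteq> 0}" by (rule summable_countable_real)
  moreover have "{i \<in> S. measure M (B i) \<noteq> 0} = S" using pos by fastforce
  ultimately show ?thesis by simp
qed

lemma dyadic_shell:
  fixes d \<delta> :: real
  assumes "0 < d" "d < \<delta>"
  obtains n where "\<delta> * (1/2) ^ n / 2 \<le> d" "d < \<delta> * (1/2) ^ n"
proof -
  have "\<exists>m. (1/2) ^ m < d / \<delta>" using assms by (intro real_arch_pow_inv) auto
  then have ex: "\<exists>m. \<delta> * (1/2) ^ m \<le> d" using assms by (auto simp: field_simps intro: less_imp_le)
  \<comment> \<open>As \<open>d < \<delta>\<close>, the least such index is not 0, and its
    predecessor is the required \<open>n\<close>.\<close>
  define m where "m = (LEAST m. \<delta> * (1/2) ^ m \<le> d)"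
  have m: "\<delta> * (1/2) ^ m \<le> d" unfolding m_def using ex by (rule LeastI_ex)
  then have "m \<noteq> 0" using assms by (cases m) auto
  then obtain n where n: "m = Suc n" by (cases m) auto
  then have "\<not> \<delta> * (1/2) ^ n \<le> d" unfolding m_def by (intro not_less_Least) simp
  with m n show ?thesis by (intro that[of n]) auto
qed

text \<open>Separates far from near: for \<open>0 \<le> s\<close> the kernel decreases with the
  distance, so outside the ball it is at most \<open>\<delta> powr - s\<close>.\<close>

lemma ennreal_dist_powr_split:
  assumes "0 \<le> s" "0 < \<delta>"
  shows "ennreal (dist x y powr - s)
    \<le> ennreal (\<delta> powr - s) + ennreal (dist x y powr - s) * indicator (ball x \<delta>) y"
proof (cases "dist x y < \<delta>")
  case False
  then have "dist x y powr - s \<le> \<delta> powr - s" using assms by (intro powr_mono2') auto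
  with False show ?thesis by (simp add: ennreal_leI)
qed simp

section \<open>Finite measures with Ahlfors growth, and measurability for them\<close>

locale ahlfors_regular_measure = finite_measure nu
  for nu :: "'a::metric_space measure" +
  fixes Y :: "'a set" and ups r0 c :: real
  assumes space_eq: "space nu = Y"
    and borel_sub: "sets (restrict_space borel Y) \<subseteq> sets nu"
    and ups_pos: "0 < ups" and r0_pos: "0 < r0" and c_pos: "0 < c"
    and regular: "\<And>x r. x \<in> Y \<Longrightarrow> 0 < r \<Longrightarrow> r < r0 \<Longrightarrow>
      emeasure nu (ball x r \<inter> Y) \<le> ennreal (c * r powr ups)"
begin

lemma borel_Int_sets: "B \<in> sets borel \<Longrightarrow> B \<inter> Y \<in> sets nu"
  using borel_sub by (auto simp: sets_restrict_space)

lemma pred_ball[measurable]: "Measurable.pred nu (\<lambda>y. y \<in> ball x t)"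
  using borel_Int_sets[of "ball x t"] by (simp add: pred_def space_eq Int_def conj_commute)

text \<open>Made for functions such as \<open>K x\<close>, which are continuous only away from
  \<open>x\<close>. The value at \<open>x\<close> changes a preimage by at most the singleton
  \<open>{x}\<close>, which is closed and hence Borel.\<close>

lemma continuous_on_measurable_nu:
  fixes f :: "'a \<Rightarrow> 'b::topological_space"
  assumes "continuous_on (Y - {x}) f"
  shows "f \<in> borel_measurable nu"
proof (rule borel_measurableI)
  fix U :: "'b set" assume "open U"
  then obtain T where T: "open T" "T \<inter> (Y - {x}) = f -` U \<inter> (Y - {x})"
    using assms by (auto simp: continuous_on_open_invariant)
  have "f -` U \<inter> space nu = ((T - {x}) \<union> (f -` U \<inter> {x})) \<inter> Y"
    using T(2) by (auto simp: space_eq)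
  moreover have "(T - {x}) \<union> (f -` U \<inter> {x}) \<in> sets borel"
  proof -
    have "f -` U \<inter> {x} = {} \<or> f -` U \<inter> {x} = {x}" by auto
    then have "f -` U \<inter> {x} \<in> sets borel" by (elim disjE) simp_all
    with T(1) show ?thesis by auto
  qed
  ultimately show "f -` U \<inter> space nu \<in> sets nu" by (simp add: borel_Int_sets)
qed

section \<open>Smallness of the local kernel in sup norm and in integral norm\<close>

text \<open>Substitute for Tonelli at one scale. The majorant is a step function on countably many
  disjoint pieces of radius \<open>2 * r\<close>, with value the integral of \<open>u\<close> over
  the ball of radius \<open>3 * r\<close> about the centre. A point \<open>y\<close> is seen only by
  pieces inside \<open>ball y (5 * r)\<close>, whence the factor \<open>V\<close>.\<close>

lemma nn_integral_ball_majorant: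
  fixes u :: "'a \<Rightarrow> ennreal"
  assumes r: "0 < r" and V: "\<And>x. x \<in> Y \<Longrightarrow> emeasure nu (ball x (5 * r) \<inter> Y) \<le> V"
    and u[measurable]: "u \<in> borel_measurable nu"
  shows "\<exists>\<Phi>\<in>borel_measurable nu. (\<forall>x\<in>Y. (\<integral>\<^sup>+y. u y * indicator (ball x r) y \<partial>nu) \<le> \<Phi> x)
    \<and> (\<integral>\<^sup>+x. \<Phi> x \<partial>nu) \<le> V * (\<integral>\<^sup>+x. u x \<partial>nu)"
proof -
  have ballS: "ball x t \<inter> Y \<in> sets nu" for x t by (rule borel_Int_sets) simp
  \<comment> \<open>Off \<open>P\<close> the integral to be majorised is zero, so only
    \<open>P\<close> has to be covered; on \<open>P\<close> the positive measures make the separated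
    set \<open>S\<close> countable.\<close>
  define P where "P = {x\<in>Y. 0 < measure nu (ball x r \<inter> Y)}"
  obtain S where S: "S \<subseteq> P" and sep: "\<And>x y. x \<in> S \<Longrightarrow> y \<in> S \<Longrightarrow> x \<noteq> y \<Longrightarrow> 2 * r \<le> dist x y"
    and net: "\<And>x. x \<in> P \<Longrightarrow> \<exists>y\<in>S. dist x y < 2 * r"
    using maximal_separated_subset[of "2 * r" P] r by auto
  have "countable S"
  proof (rule countable_disjoint_positive_measure)
    show "disjoint_family_on (\<lambda>x. ball x r \<inter> Y) S"
      unfolding disjoint_family_on_def
    proof (intro ballI impI)
      fix x y assume "x \<in> S" "y \<in> S" "x \<noteq> y"
      from sep[OF this] have "ball x r \<inter> ball y r = {}" by (intro disjoint_ballI) simp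
      then show "(ball x r \<inter> Y) \<inter> (ball y r \<inter> Y) = {}" by blast
    qed
  qed (use S ballS in \<open>auto simp: P_def\<close>)
  have null: "(\<integral>\<^sup>+y. u y * indicator (ball x r) y \<partial>nu) = 0" if "x \<in> Y" "x \<notin> P" for x
  proof -
    have "measure nu (ball x r \<inter> Y) = 0"
      using that measure_nonneg[of nu "ball x r \<inter> Y"] by (auto simp: P_def not_less)
    then have "ball x r \<inter> Y \<in> null_sets nu" using ballS by (simp add: emeasure_eq_measure null_sets_def)
    then have "AE y in nu. y \<notin> ball x r \<inter> Y" by (rule AE_not_in)
    then have "AE y in nu. u y * indicator (ball x r) y = 0"
      by (rule AE_mp) (auto simp: space_eq intro!: AE_I2)
    then show ?thesis by (simp add: nn_integral_0_iff_AE)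
  qed
  show ?thesis
  proof (cases "S = {}")
    case True
    then have "P = {}" using net by auto
    then show ?thesis using null by (intro bexI[of _ "\<lambda>_. 0"]) auto
  next
    case False
    define e where "e = from_nat_into S"
    have e: "range e = S" unfolding e_def using False \<open>countable S\<close> by (rule range_from_nat_into)
    \<comment> \<open>The balls are made disjoint so that their measures can be added later. If
      \<open>S\<close> is finite, the enumeration \<open>e\<close> repeats centres, and the repeated
      pieces become empty.\<close>
    define D where "D = disjointed (\<lambda>n. ball (e n) (2 * r) \<inter> Y)"
    have DS: "D n \<in> sets nu" for n
      using sets.range_disjointed_sets[of "\<lambda>n. ball (e n) (2 * r) \<inter> Y" nu] ballS by (auto simp: D_def)
    have [measurable]: "Measurable.pred nu (\<lambda>y. y \<in> D n)" for n
      using DS[of n] sets.sets_into_space[OF DS[of n]]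
      by (simp add: pred_def Int_def[symmetric] inf.absorb2 Collect_conj_eq Int_absorb1)
    have Dsub: "D n \<subseteq> ball (e n) (2 * r) \<inter> Y" for n unfolding D_def by (rule disjointed_subset)
    \<comment> \<open>Radius \<open>3 * r = 2 * r + r\<close>: for \<open>x\<close> in
      \<open>D n\<close>, the ball of radius \<open>r\<close> about \<open>x\<close> lies in this
      one.\<close>
    define m where "m n = (\<integral>\<^sup>+y. u y * indicator (ball (e n) (3 * r)) y \<partial>nu)" for n
    define \<Phi> where "\<Phi> x = (\<Sum>n. m n * indicator (D n) x)" for x
    have meas: "\<Phi> \<in> borel_measurable nu" unfolding \<Phi>_def by measurable
    have "(\<integral>\<^sup>+y. u y * indicator (ball x r) y \<partial>nu) \<le> \<Phi> x" if x: "x \<in> Y" for x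
    proof (cases "x \<in> P")
      case False
      then show ?thesis using null x by simp
    next
      case True
      have "\<exists>y\<in>S. dist x y < 2 * r" using net[OF True] .
      then have "x \<in> (\<Union>n. ball (e n) (2 * r) \<inter> Y)" using x e by (force simp: dist_commute)
      then have "x \<in> (\<Union>n. D n)" unfolding D_def UN_disjointed_eq .
      then obtain n where n: "x \<in> D n" by blast
      have d: "dist (e n) x < 2 * r" using n Dsub[of n] by auto
      have "(\<integral>\<^sup>+y. u y * indicator (ball x r) y \<partial>nu) \<le> m n" unfolding m_def
      proof (rule nn_integral_mono)
        fix y
        have "y \<in> ball (e n) (3 * r)" if "y \<in> ball x r"
          using that d dist_triangle[of "e n" y x] by auto
        then show "u y * indicator (ball x r) y \<le> u y * indicator (ball (e n) (3 * r)) y"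
          by (auto simp: indicator_def)
      qed
      also have "m n = (\<Sum>k\<in>{n}. m k * indicator (D k) x)" using n by simp
      also have "\<dots> \<le> \<Phi> x" unfolding \<Phi>_def by (rule sum_le_suminf) auto
      finally show ?thesis .
    qed
    \<comment> \<open>Only a countable sum and a single integral are interchanged, so measurability
      on the product space does not enter.\<close>
    moreover have "(\<integral>\<^sup>+x. \<Phi> x \<partial>nu) \<le> V * (\<integral>\<^sup>+x. u x \<partial>nu)"
    proof -
      have "(\<integral>\<^sup>+x. \<Phi> x \<partial>nu) = (\<Sum>n. m n * emeasure nu (D n))"
        unfolding \<Phi>_def by (subst nn_integral_suminf) (auto simp: nn_integral_cmult_indicator DS)
      also have "\<dots> = (\<Sum>n. \<integral>\<^sup>+y. u y * indicator (ball (e n) (3 * r)) y * emeasure nu (D n) \<partial>nu)"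
        unfolding m_def by (subst nn_integral_multc) auto
      also have "\<dots> = (\<integral>\<^sup>+y. (\<Sum>n. u y * indicator (ball (e n) (3 * r)) y * emeasure nu (D n)) \<partial>nu)"
        by (rule nn_integral_suminf[symmetric]) measurable
      also have "\<dots> \<le> (\<integral>\<^sup>+y. V * u y \<partial>nu)"
      proof (rule nn_integral_mono)
        fix y assume "y \<in> space nu"
        then have y: "y \<in> Y" by (simp add: space_eq)
        \<comment> \<open>For fixed \<open>y\<close>, these are the pieces whose value counts the
          mass of \<open>u\<close> at \<open>y\<close>. They are disjoint and lie within
          \<open>3 * r + 2 * r\<close> of \<open>y\<close>.\<close>
        define E where "E n = (if dist (e n) y < 3 * r then D n else {})" for n
        have Esub: "E n \<subseteq> D n" for n by (simp add: E_def)
        have ES: "range E \<subseteq> sets nu" using DS by (auto simp: E_def)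
        have "disjoint_family D" unfolding D_def by (rule disjoint_family_disjointed)
        then have Ed: "disjoint_family E" using Esub unfolding disjoint_family_on_def by blast
        have "(\<Sum>n. u y * indicator (ball (e n) (3 * r)) y * emeasure nu (D n)) = (\<Sum>n. u y * emeasure nu (E n))"
          by (intro suminf_cong) (auto simp: E_def indicator_def)
        also have "\<dots> = u y * (\<Sum>n. emeasure nu (E n))" by simp
        also have "(\<Sum>n. emeasure nu (E n)) = emeasure nu (\<Union>n. E n)" using ES Ed by (rule suminf_emeasure)
        also have "u y * \<dots> \<le> u y * V"
        proof (rule mult_left_mono)
          have "emeasure nu (\<Union>n. E n) \<le> emeasure nu (ball y (5 * r) \<inter> Y)"
          proof (rule emeasure_mono)
            show "(\<Union>n. E n) \<subseteq> ball y (5 * r) \<inter> Y"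
            proof
              fix z assume "z \<in> (\<Union>n. E n)"
              then obtain n where "z \<in> D n" "dist (e n) y < 3 * r" by (auto simp: E_def split: if_splits)
              then show "z \<in> ball y (5 * r) \<inter> Y"
                using Dsub[of n] dist_triangle[of y z "e n"] by (auto simp: dist_commute)
            qed
          qed (rule ballS)
          also have "\<dots> \<le> V" using V y by simp
          finally show "emeasure nu (\<Union>n. E n) \<le> V" .
        qed simp
        finally show "(\<Sum>n. u y * indicator (ball (e n) (3 * r)) y * emeasure nu (D n)) \<le> V * u y"
          by (simp only: mult.commute)
      qed
      also have "\<dots> = V * (\<integral>\<^sup>+x. u x \<partial>nu)" by (rule nn_integral_cmult) measurable
      finally show ?thesis .
    qed
    ultimately show ?thesis using meas by blast
  qed
qed

text \<open>Since \<open>0 powr - s = 0\<close>, the kernel \<open>dist x y powr - s\<close> vanishes on the (null) diagonal.\<close>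

lemma local_kernel_small:
  assumes s: "0 \<le> s" "s < ups" and \<epsilon>: "0 < \<epsilon>"
  obtains \<delta> where "0 < \<delta>"
    "\<And>x. x \<in> Y \<Longrightarrow> (\<integral>\<^sup>+y. ennreal (dist x y powr - s) * indicator (ball x \<delta>) y \<partial>nu) \<le> ennreal \<epsilon>"
    "\<And>u. u \<in> borel_measurable nu \<Longrightarrow> \<exists>\<Phi>\<in>borel_measurable nu.
      (\<forall>x\<in>Y. (\<integral>\<^sup>+y. u y * (ennreal (dist x y powr - s) * indicator (ball x \<delta>) y) \<partial>nu) \<le> \<Phi> x)
      \<and> (\<integral>\<^sup>+x. \<Phi> x \<partial>nu) \<le> ennreal \<epsilon> * (\<integral>\<^sup>+x. u x \<partial>nu)"
proof -
  define a where "a = ups - s"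
  have a: "0 < a" using s by (simp add: a_def)
  define q :: real where "q = (1/2) powr a"
  have q: "0 < q" "q < 1" using powr_less_mono2[of a "1/2" 1] a by (auto simp: q_def)
  \<comment> \<open>\<open>D * \<delta> powr a\<close> is the sum of the geometric series with ratio
    \<open>q\<close> formed below; the factors \<open>5 powr ups\<close> and \<open>2 powr s\<close>
    come from the radius \<open>5 * r n\<close> in \<open>b n\<close> and the radius
    \<open>r n / 2\<close> in \<open>w n\<close>.\<close>
  define D where "D = c * 5 powr ups * 2 powr s / (1 - q)"
  have D: "0 < D" using q c_pos by (simp add: D_def)
  \<comment> \<open>The first entry keeps all radii \<open>5 * r n\<close> below \<open>r0\<close>,
    where regularity applies; the second gives
    \<open>D * \<delta> powr a \<le> \<epsilon>\<close>.\<close>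
  define \<delta> where "\<delta> = min (r0 / 10) ((\<epsilon> / D) powr (1 / a))"
  have \<delta>: "0 < \<delta>" "5 * \<delta> < r0" using r0_pos \<epsilon> D by (auto simp: \<delta>_def min_def)
  have "\<delta> powr a \<le> ((\<epsilon> / D) powr (1 / a)) powr a"
    using \<delta> a by (intro powr_mono2) (auto simp: \<delta>_def)
  also have "\<dots> = \<epsilon> / D" using a \<epsilon> D by (simp add: powr_powr)
  finally have D\<epsilon>: "D * \<delta> powr a \<le> \<epsilon>" using D by (simp add: field_simps)
  define r where "r n = \<delta> * (1/2) ^ n" for n :: nat
  \<comment> \<open>\<open>w n\<close> bounds the kernel on the n-th dyadic shell, being its value
    at the inner radius; \<open>b n\<close> bounds the measure of a ball of radius
    \<open>5 * r n\<close>.\<close>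
  define w where "w n = (r n / 2) powr - s" for n
  define b where "b n = c * (5 * r n) powr ups" for n
  have r: "0 < r n" for n using \<delta> by (simp add: r_def)
  have r5: "5 * r n < r0" for n
  proof -
    have "r n \<le> \<delta> * 1" unfolding r_def using \<delta> by (intro mult_left_mono power_le_one) auto
    then show ?thesis using \<delta> by simp
  qed
  have w0: "0 \<le> w n" and b0: "0 \<le> b n" for n using c_pos by (auto simp: w_def b_def)
  have wb: "w n * b n = c * 5 powr ups * 2 powr s * \<delta> powr a * q ^ n" for n
  proof -
    have "w n = r n powr - s * 2 powr s"
      using r[of n] by (simp add: w_def powr_divide powr_minus field_simps)
    moreover have "b n = c * 5 powr ups * r n powr ups"
      using r[of n] by (simp add: b_def powr_mult)
    moreover have "r n powr - s * r n powr ups = r n powr a"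
      by (simp add: a_def powr_add[symmetric])
    moreover have "r n powr a = \<delta> powr a * q ^ n"
      using \<delta> by (simp add: r_def q_def powr_mult powr_power powr_powr mult.commute flip: powr_realpow)
    ultimately show ?thesis by (metis (no_types, lifting) mult.assoc mult.commute)
  qed
  have "(\<lambda>n. w n * b n) sums (c * 5 powr ups * 2 powr s * \<delta> powr a * (1 / (1 - q)))"
    unfolding wb using q by (intro sums_mult geometric_sums) auto
  then have "(\<lambda>n. w n * b n) sums (D * \<delta> powr a)" by (simp add: D_def)
  then have "(\<Sum>n. ennreal (w n * b n)) = ennreal (D * \<delta> powr a)"
    using w0 b0 by (intro suminf_ennreal_eq) auto
  then have sum: "(\<Sum>n. ennreal (w n) * ennreal (b n)) \<le> ennreal \<epsilon>"
    using D\<epsilon> w0 b0 by (simp add: ennreal_mult[symmetric] ennreal_leI)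
  have V5: "emeasure nu (ball x (5 * r n) \<inter> Y) \<le> ennreal (b n)" if "x \<in> Y" for x n
    unfolding b_def using that r r5 by (intro regular) auto
  \<comment> \<open>If \<open>0 < dist x y < \<delta>\<close>, the term of the shell containing
    \<open>y\<close> alone dominates the kernel; otherwise the left-hand side is 0.\<close>
  have dom: "ennreal (dist x y powr - s) * indicator (ball x \<delta>) y
      \<le> (\<Sum>n. ennreal (w n) * indicator (ball x (r n)) y)" for x y
  proof (cases "0 < dist x y \<and> dist x y < \<delta>")
    case True
    then obtain n where n: "r n / 2 \<le> dist x y" "dist x y < r n"
      using dyadic_shell[of "dist x y" \<delta>] unfolding r_def by blast
    have "dist x y powr - s \<le> w n"
      unfolding w_def using n r[of n] s by (intro powr_mono2') auto
    then have "ennreal (dist x y powr - s) * indicator (ball x \<delta>) y \<le> ennreal (w n) * indicator (ball x (r n)) y"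
      using n True by (simp add: ennreal_leI)
    also have "\<dots> = (\<Sum>k\<in>{n}. ennreal (w k) * indicator (ball x (r k)) y)"
      by (simp only: sum.insert finite.emptyI empty_iff not_False_eq_True sum.empty add_0_right)
    also have "\<dots> \<le> (\<Sum>n. ennreal (w n) * indicator (ball x (r n)) y)" by (rule sum_le_suminf) auto
    finally show ?thesis .
  next
    case False
    then show ?thesis by (auto simp: indicator_def)
  qed
  \<comment> \<open>Stated for an arbitrary density: \<open>u = 1\<close> yields the pointwise
    bound, general \<open>u\<close> the integral bound.\<close>
  have int: "(\<integral>\<^sup>+y. u y * (ennreal (dist x y powr - s) * indicator (ball x \<delta>) y) \<partial>nu)
      \<le> (\<Sum>n. ennreal (w n) * (\<integral>\<^sup>+y. u y * indicator (ball x (r n)) y \<partial>nu))"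
    if u[measurable]: "u \<in> borel_measurable nu" for u x
  proof -
    have "(\<integral>\<^sup>+y. u y * (ennreal (dist x y powr - s) * indicator (ball x \<delta>) y) \<partial>nu)
        \<le> (\<integral>\<^sup>+y. u y * (\<Sum>n. ennreal (w n) * indicator (ball x (r n)) y) \<partial>nu)"
      by (intro nn_integral_mono mult_left_mono dom) simp
    also have "\<dots> = (\<integral>\<^sup>+y. (\<Sum>n. ennreal (w n) * (u y * indicator (ball x (r n)) y)) \<partial>nu)"
      by (simp add: ennreal_suminf_cmult[symmetric] mult.left_commute del: ennreal_suminf_cmult)
    also have "\<dots> = (\<Sum>n. \<integral>\<^sup>+y. ennreal (w n) * (u y * indicator (ball x (r n)) y) \<partial>nu)"
      by (rule nn_integral_suminf) measurable
    also have "\<dots> = (\<Sum>n. ennreal (w n) * (\<integral>\<^sup>+y. u y * indicator (ball x (r n)) y \<partial>nu))"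
      by (subst nn_integral_cmult) auto
    finally show ?thesis .
  qed
  show ?thesis
  proof (rule that[OF \<delta>(1)])
    fix x assume x: "x \<in> Y"
    have "(\<integral>\<^sup>+y. ennreal (dist x y powr - s) * indicator (ball x \<delta>) y \<partial>nu)
        \<le> (\<Sum>n. ennreal (w n) * (\<integral>\<^sup>+y. indicator (ball x (r n)) y \<partial>nu))"
      using int[of "\<lambda>_. 1" x] by simp
    also have "\<dots> \<le> (\<Sum>n. ennreal (w n) * ennreal (b n))"
    proof (intro suminf_le mult_left_mono)
      fix n
      have "(\<integral>\<^sup>+y. indicator (ball x (r n)) y \<partial>nu) = emeasure nu (ball x (r n) \<inter> Y)"
        by (subst nn_integral_indicator') (auto simp: space_eq borel_Int_sets)
      also have "\<dots> \<le> emeasure nu (ball x (5 * r n) \<inter> Y)"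
        using r[of n] by (intro emeasure_mono borel_Int_sets) auto
      also have "\<dots> \<le> ennreal (b n)" using V5 x .
      finally show "(\<integral>\<^sup>+y. indicator (ball x (r n)) y \<partial>nu) \<le> ennreal (b n)" .
    qed auto
    also note sum
    finally show "(\<integral>\<^sup>+y. ennreal (dist x y powr - s) * indicator (ball x \<delta>) y \<partial>nu) \<le> ennreal \<epsilon>" .
  next
    fix u :: "'a \<Rightarrow> ennreal" assume u[measurable]: "u \<in> borel_measurable nu"
    \<comment> \<open>One majorant for each scale; weighted by \<open>w n\<close> and summed, they
      majorise the whole local potential.\<close>
    have "\<forall>n. \<exists>\<Phi>. \<Phi> \<in> borel_measurable nu \<and> (\<forall>x\<in>Y. (\<integral>\<^sup>+y. u y * indicator (ball x (r n)) y \<partial>nu) \<le> \<Phi> x)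
        \<and> (\<integral>\<^sup>+x. \<Phi> x \<partial>nu) \<le> ennreal (b n) * (\<integral>\<^sup>+x. u x \<partial>nu)"
      using nn_integral_ball_majorant[OF r V5 u] by (intro allI) auto
    then obtain \<Phi> where [measurable]: "\<And>n. \<Phi> n \<in> borel_measurable nu"
      and \<Phi>: "\<And>n x. x \<in> Y \<Longrightarrow> (\<integral>\<^sup>+y. u y * indicator (ball x (r n)) y \<partial>nu) \<le> \<Phi> n x"
        "\<And>n. (\<integral>\<^sup>+x. \<Phi> n x \<partial>nu) \<le> ennreal (b n) * (\<integral>\<^sup>+x. u x \<partial>nu)"
      by (auto dest!: choice)
    show "\<exists>\<Phi>\<in>borel_measurable nu.
      (\<forall>x\<in>Y. (\<integral>\<^sup>+y. u y * (ennreal (dist x y powr - s) * indicator (ball x \<delta>) y) \<partial>nu) \<le> \<Phi> x)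
      \<and> (\<integral>\<^sup>+x. \<Phi> x \<partial>nu) \<le> ennreal \<epsilon> * (\<integral>\<^sup>+x. u x \<partial>nu)"
    proof (intro bexI[of _ "\<lambda>x. \<Sum>n. ennreal (w n) * \<Phi> n x"] conjI ballI)
      fix x assume "x \<in> Y"
      then show "(\<integral>\<^sup>+y. u y * (ennreal (dist x y powr - s) * indicator (ball x \<delta>) y) \<partial>nu)
          \<le> (\<Sum>n. ennreal (w n) * \<Phi> n x)"
        by (intro order_trans[OF int[OF u]] suminf_le mult_left_mono \<Phi>) auto
    next
      have "(\<integral>\<^sup>+x. (\<Sum>n. ennreal (w n) * \<Phi> n x) \<partial>nu) = (\<Sum>n. ennreal (w n) * (\<integral>\<^sup>+x. \<Phi> n x \<partial>nu))"
        by (subst nn_integral_suminf) (auto simp: nn_integral_cmult)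
      also have "\<dots> \<le> (\<Sum>n. ennreal (w n) * (ennreal (b n) * (\<integral>\<^sup>+x. u x \<partial>nu)))"
        by (intro suminf_le mult_left_mono \<Phi>) auto
      also have "\<dots> = (\<Sum>n. ennreal (w n) * ennreal (b n)) * (\<integral>\<^sup>+x. u x \<partial>nu)"
        by (simp add: mult.assoc[symmetric])
      also have "\<dots> \<le> ennreal \<epsilon> * (\<integral>\<^sup>+x. u x \<partial>nu)" by (intro mult_right_mono sum) simp
      finally show "(\<integral>\<^sup>+x. (\<Sum>n. ennreal (w n) * \<Phi> n x) \<partial>nu) \<le> ennreal \<epsilon> * (\<integral>\<^sup>+x. u x \<partial>nu)" .
    qed measurable
  qed
qed

section \<open>Null points and the uniform bound for the singular integral\<close>

text \<open>An atom at \<open>x\<close> would have mass at most \<open>c * r powr ups\<close> for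
  all small \<open>r\<close>, and this tends to 0 because \<open>0 < ups\<close>.\<close>

lemma AE_neq_point:
  assumes "x \<in> Y"
  shows "AE y in nu. y \<noteq> x"
proof -
  have "{x} \<inter> Y \<in> sets nu" by (rule borel_Int_sets) simp
  then have S: "{x} \<in> sets nu" using assms by (simp add: Int_absorb2)
  have "measure nu {x} = 0"
  proof (rule ccontr)
    assume "measure nu {x} \<noteq> 0"
    then have m: "0 < measure nu {x}" by (simp add: zero_less_measure_iff)
    define m where "m = measure nu {x}"
    \<comment> \<open>Chosen so that \<open>c * r powr ups \<le> m / 2\<close> with
      \<open>r < r0\<close>, which contradicts \<open>0 < m\<close>.\<close>
    define r where "r = min (r0 / 2) ((m / (2 * c)) powr (1 / ups))"
    have m0: "0 < m" using m by (simp add: m_def)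
    have r: "0 < r" "r < r0" using r0_pos c_pos m0 by (auto simp: r_def min_def)
    have "emeasure nu {x} \<le> emeasure nu (ball x r \<inter> Y)"
      using assms r by (intro emeasure_mono borel_Int_sets) auto
    also have "\<dots> \<le> ennreal (c * r powr ups)" using assms r by (intro regular)
    finally have "m \<le> c * r powr ups"
      using c_pos by (simp add: emeasure_eq_measure m_def ennreal_le_iff)
    also have "r powr ups \<le> ((m / (2 * c)) powr (1 / ups)) powr ups"
      using r ups_pos by (intro powr_mono2) (auto simp: r_def)
    also have "\<dots> = m / (2 * c)" using ups_pos m0 c_pos by (simp add: powr_powr)
    finally have "m \<le> m / 2" using c_pos by (simp add: mult_left_mono)
    with m0 show False by simp
  qed
  then have "{x} \<in> null_sets nu" using S by (simp add: null_sets_def emeasure_eq_measure)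
  then show ?thesis using AE_not_in by fastforce
qed

lemma dist_powr_measurable[measurable]: "(\<lambda>y. dist x y powr a) \<in> borel_measurable nu"
  by (rule continuous_on_measurable_nu[where x = x]) (auto intro!: continuous_intros)

text \<open>The local part contributes at most 1 for a suitable \<open>\<delta>\<close>; the far
  part is at most \<open>\<delta> powr - s\<close> times the finite total mass.\<close>

lemma nn_integral_dist_powr_bounded:
  assumes "0 \<le> s" "s < ups"
  obtains R where "0 \<le> R" "\<And>x. x \<in> Y \<Longrightarrow> (\<integral>\<^sup>+y. ennreal (dist x y powr - s) \<partial>nu) \<le> ennreal R"
proof -
  obtain \<delta> where \<delta>: "0 < \<delta>"
    and row: "\<And>x. x \<in> Y \<Longrightarrow> (\<integral>\<^sup>+y. ennreal (dist x y powr - s) * indicator (ball x \<delta>) y \<partial>nu) \<le> ennreal 1"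
    using local_kernel_small[OF assms zero_less_one] by metis
  define R where "R = \<delta> powr - s * measure nu Y + 1"
  show ?thesis
  proof (rule that[of R])
    fix x assume x: "x \<in> Y"
    have "(\<integral>\<^sup>+y. ennreal (dist x y powr - s) \<partial>nu)
        \<le> (\<integral>\<^sup>+y. ennreal (\<delta> powr - s) + ennreal (dist x y powr - s) * indicator (ball x \<delta>) y \<partial>nu)"
      using assms \<delta> by (intro nn_integral_mono ennreal_dist_powr_split)
    also have "\<dots> = ennreal (\<delta> powr - s) * emeasure nu Y
        + (\<integral>\<^sup>+y. ennreal (dist x y powr - s) * indicator (ball x \<delta>) y \<partial>nu)"
      by (subst nn_integral_add) (auto simp: space_eq)
    also have "\<dots> \<le> ennreal (\<delta> powr - s) * emeasure nu Y + ennreal 1"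
      using row[OF x] by (rule add_left_mono)
    also have "\<dots> = ennreal R"
      by (simp add: R_def emeasure_eq_measure ennreal_mult)
    finally show "(\<integral>\<^sup>+y. ennreal (dist x y powr - s) \<partial>nu) \<le> ennreal R" .
  qed (simp add: R_def)
qed

section \<open>Essential boundedness of the density\<close>

lemma essentially_bounded_of_potential_bound:
  fixes u :: "'a \<Rightarrow> ennreal"
  assumes s: "0 \<le> s" "s < ups" and C: "0 \<le> C"
    and u[measurable]: "u \<in> borel_measurable nu" and fin: "(\<integral>\<^sup>+x. u x \<partial>nu) < \<infinity>" and G: "G < \<infinity>"
    and le: "AE x in nu. u x \<le> G + ennreal C * (\<integral>\<^sup>+y. u y * ennreal (dist x y powr - s) \<partial>nu)"
  obtains B :: real where "0 \<le> B" "AE x in nu. u x \<le> ennreal B"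
proof -
  \<comment> \<open>Ensures \<open>C * \<epsilon> \<le> 1/2\<close>; adding 1 covers the case
    \<open>C = 0\<close>.\<close>
  define \<epsilon> where "\<epsilon> = 1 / (2 * (C + 1))"
  have \<epsilon>: "0 < \<epsilon>" "C * \<epsilon> \<le> 1/2" using C by (auto simp: \<epsilon>_def field_simps)
  then have C\<epsilon>: "ennreal C * ennreal \<epsilon> \<le> ennreal (1/2)"
    using C by (simp only: ennreal_mult[symmetric] less_imp_le) (rule ennreal_leI)
  obtain \<delta> where \<delta>: "0 < \<delta>"
    and row: "\<And>x. x \<in> Y \<Longrightarrow> (\<integral>\<^sup>+y. ennreal (dist x y powr - s) * indicator (ball x \<delta>) y \<partial>nu) \<le> ennreal \<epsilon>"
    and col: "\<And>u. u \<in> borel_measurable nu \<Longrightarrow> \<exists>\<Phi>\<in>borel_measurable nu.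
      (\<forall>x\<in>Y. (\<integral>\<^sup>+y. u y * (ennreal (dist x y powr - s) * indicator (ball x \<delta>) y) \<partial>nu) \<le> \<Phi> x)
      \<and> (\<integral>\<^sup>+x. \<Phi> x \<partial>nu) \<le> ennreal \<epsilon> * (\<integral>\<^sup>+x. u x \<partial>nu)"
    by (rule local_kernel_small[OF s \<epsilon>(1)]) (rule that)
  define k where "k x y = ennreal (dist x y powr - s) * indicator (ball x \<delta>) y" for x y :: 'a
  have [measurable]: "k x \<in> borel_measurable nu" for x unfolding k_def by measurable
  \<comment> \<open>\<open>B\<close> collects \<open>G\<close> and the far part of the potential,
    which is finite because \<open>u\<close> is integrable.\<close>
  define B where "B = G + ennreal C * (ennreal (\<delta> powr - s) * (\<integral>\<^sup>+x. u x \<partial>nu))"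
  have Bfin: "B < \<infinity>" unfolding B_def using G fin by (simp add: ennreal_mult_less_top)
  \<comment> \<open>Subtraction in \<open>ennreal\<close> is truncated, so this is the positive part
    of \<open>u - 2 * B\<close>. The level \<open>2 * B\<close> reproduces itself: the local
    potential of the constant \<open>2 * B\<close>, multiplied by \<open>C\<close>, is at most
    \<open>B\<close>, and the remaining terms contribute another \<open>B\<close>.\<close>
  define w where "w x = u x - 2 * B" for x
  have [measurable]: "w \<in> borel_measurable nu" unfolding w_def by measurable
  have uw: "u x \<le> 2 * B + w x" for x unfolding w_def
    by (metis add.commute diff_add_cancel_ennreal le_cases add_increasing2 order_refl zero_le)
  obtain \<Phi> where [measurable]: "\<Phi> \<in> borel_measurable nu"
    and \<Phi>: "\<And>x. x \<in> Y \<Longrightarrow> (\<integral>\<^sup>+y. w y * k x y \<partial>nu) \<le> \<Phi> x"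
      "(\<integral>\<^sup>+x. \<Phi> x \<partial>nu) \<le> ennreal \<epsilon> * (\<integral>\<^sup>+x. w x \<partial>nu)"
    using col[of w] unfolding k_def by auto
  have far: "(\<integral>\<^sup>+y. u y * ennreal (dist x y powr - s) \<partial>nu)
      \<le> ennreal (\<delta> powr - s) * (\<integral>\<^sup>+x. u x \<partial>nu) + (\<integral>\<^sup>+y. u y * k x y \<partial>nu)" for x
  proof -
    have "(\<integral>\<^sup>+y. u y * ennreal (dist x y powr - s) \<partial>nu)
      \<le> (\<integral>\<^sup>+y. ennreal (\<delta> powr - s) * u y + u y * k x y \<partial>nu)"
    proof (rule nn_integral_mono)
      fix y
      have "u y * ennreal (dist x y powr - s) \<le> u y * (ennreal (\<delta> powr - s) + k x y)"
        unfolding k_def using s \<delta> by (intro mult_left_mono ennreal_dist_powr_split) auto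
      then show "u y * ennreal (dist x y powr - s) \<le> ennreal (\<delta> powr - s) * u y + u y * k x y"
        by (simp add: distrib_left mult.commute)
    qed
    also have "\<dots> = ennreal (\<delta> powr - s) * (\<integral>\<^sup>+x. u x \<partial>nu) + (\<integral>\<^sup>+y. u y * k x y \<partial>nu)"
      by (subst nn_integral_add) (auto simp: nn_integral_cmult)
    finally show ?thesis .
  qed
  \<comment> \<open>From \<open>u \<le> 2 * B + w\<close>: the constant is handled by the pointwise
    bound, \<open>w\<close> by its majorant.\<close>
  have near: "(\<integral>\<^sup>+y. u y * k x y \<partial>nu) \<le> 2 * B * ennreal \<epsilon> + \<Phi> x" if x: "x \<in> Y" for x
  proof -
    have "(\<integral>\<^sup>+y. u y * k x y \<partial>nu) \<le> (\<integral>\<^sup>+y. 2 * B * k x y + w y * k x y \<partial>nu)"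
      using uw by (intro nn_integral_mono) (simp add: distrib_right[symmetric] mult_right_mono)
    also have "\<dots> = 2 * B * (\<integral>\<^sup>+y. k x y \<partial>nu) + (\<integral>\<^sup>+y. w y * k x y \<partial>nu)"
      by (subst nn_integral_add) (auto simp: nn_integral_cmult)
    also have "\<dots> \<le> 2 * B * ennreal \<epsilon> + \<Phi> x"
      using row[OF x] \<Phi>(1)[OF x] unfolding k_def by (intro add_mono mult_left_mono) auto
    finally show ?thesis .
  qed
  have half: "2 * ennreal (1/2) = 1"
    using ennreal_mult[of 2 "1/2"] by simp
  have wle: "AE x in nu. w x \<le> ennreal C * \<Phi> x"
    using le
  proof (rule AE_mp, intro AE_I2 impI)
    fix x assume "x \<in> space nu" and ux: "u x \<le> G + ennreal C * (\<integral>\<^sup>+y. u y * ennreal (dist x y powr - s) \<partial>nu)"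
    then have x: "x \<in> Y" by (simp add: space_eq)
    note ux
    also have "G + ennreal C * (\<integral>\<^sup>+y. u y * ennreal (dist x y powr - s) \<partial>nu)
      \<le> G + ennreal C * (ennreal (\<delta> powr - s) * (\<integral>\<^sup>+x. u x \<partial>nu) + (2 * B * ennreal \<epsilon> + \<Phi> x))"
      by (intro add_left_mono mult_left_mono order_trans[OF far] near[OF x]) simp
    also have "\<dots> = B + (ennreal C * ennreal \<epsilon>) * 2 * B + ennreal C * \<Phi> x"
      by (simp add: B_def distrib_left ac_simps)
    also have "\<dots> \<le> B + ennreal (1/2) * 2 * B + ennreal C * \<Phi> x"
      by (intro add_mono mult_right_mono C\<epsilon>) auto
    also have "\<dots> = 2 * B + ennreal C * \<Phi> x" using half by (simp only: mult.commute[of _ 2] mult_1) (simp only: mult_2)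
    finally show "w x \<le> ennreal C * \<Phi> x" unfolding w_def
      using Bfin by (subst ennreal_minus_le_iff) (auto simp: top_unique ennreal_mult_eq_top_iff)
  qed
  have "(\<integral>\<^sup>+x. w x \<partial>nu) \<le> (\<integral>\<^sup>+x. u x \<partial>nu)" unfolding w_def by (intro nn_integral_mono) simp
  \<comment> \<open>Finiteness is essential: the inequality \<open>W\<close> below forces the
    integral to vanish only if it is not infinite.\<close>
  then have wfin: "(\<integral>\<^sup>+x. w x \<partial>nu) < \<infinity>" using fin by (rule le_less_trans)
  have "(\<integral>\<^sup>+x. w x \<partial>nu) \<le> (\<integral>\<^sup>+x. ennreal C * \<Phi> x \<partial>nu)" by (intro nn_integral_mono_AE wle)
  also have "\<dots> = ennreal C * (\<integral>\<^sup>+x. \<Phi> x \<partial>nu)" by (rule nn_integral_cmult) measurable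
  also have "\<dots> \<le> ennreal C * (ennreal \<epsilon> * (\<integral>\<^sup>+x. w x \<partial>nu))" by (intro mult_left_mono \<Phi>) simp
  also have "\<dots> \<le> ennreal (1/2) * (\<integral>\<^sup>+x. w x \<partial>nu)"
    by (simp only: mult.assoc[symmetric]) (intro mult_right_mono C\<epsilon>, simp)
  finally have W: "(\<integral>\<^sup>+x. w x \<partial>nu) \<le> ennreal (1/2) * (\<integral>\<^sup>+x. w x \<partial>nu)" .
  have "(\<integral>\<^sup>+x. w x \<partial>nu) = 0"
  proof -
    obtain t where t: "0 \<le> t" "(\<integral>\<^sup>+x. w x \<partial>nu) = ennreal t"
      using wfin by (cases "\<integral>\<^sup>+x. w x \<partial>nu") auto
    have "ennreal (1/2 * t) = ennreal (1/2) * ennreal t" using t by (intro ennreal_mult) auto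
    with W have "ennreal t \<le> ennreal (1/2 * t)" by (simp only: t(2))
    then have "t \<le> 1/2 * t" using t by (subst (asm) ennreal_le_iff) auto
    then show ?thesis using t by simp
  qed
  then have w0: "AE x in nu. w x = 0" by (simp add: nn_integral_0_iff_AE)
  have B2: "2 * B = ennreal (enn2real (2 * B))" using Bfin by (simp add: ennreal_mult_less_top)
  from w0 have "AE x in nu. u x \<le> ennreal (enn2real (2 * B))"
  proof eventually_elim
    case (elim x)
    with uw[of x] have "u x \<le> 2 * B" by simp
    then show ?case by (simp only: B2[symmetric])
  qed
  then show ?thesis by (intro that) auto
qed

end

section \<open>Bounds and separate continuity of kernels; uniform approximation\<close>

lemma kernel_class_bound:
  assumes "K \<in> kernel_class s Y"
  obtains C where "0 \<le> C"
    "\<And>x y. x \<in> Y \<Longrightarrow> y \<in> Y \<Longrightarrow> x \<noteq> y \<Longrightarrow> norm (K x y) \<le> C * dist x y powr - s"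
proof -
  obtain C where C: "\<And>x y. x \<in> Y \<Longrightarrow> y \<in> Y \<Longrightarrow> x \<noteq> y \<Longrightarrow> norm (K x y) * dist x y powr s \<le> C"
    using assms unfolding kernel_class_def by blast
  \<comment> \<open>The constant supplied by the class can be negative when \<open>Y\<close> has no
    two distinct points, hence the maximum with 0.\<close>
  show ?thesis
  proof (rule that[of "max C 0"])
    fix x y assume xy: "x \<in> Y" "y \<in> Y" "x \<noteq> y"
    then have "norm (K x y) * dist x y powr s \<le> max C 0" using C[OF xy] by simp
    then show "norm (K x y) \<le> max C 0 * dist x y powr - s"
      using xy by (simp add: powr_minus field_simps)
  qed simp
qed

lemma kernel_class_continuous_left:
  assumes "K \<in> kernel_class s Y" "y \<in> Y"
  shows "continuous_on (Y - {y}) (\<lambda>x. K x y)"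
proof -
  have "continuous_on {(x, y). x \<in> Y \<and> y \<in> Y \<and> x \<noteq> y} (\<lambda>(x, y). K x y)"
    using assms(1) by (simp add: kernel_class_def)
  moreover have "continuous_on (Y - {y}) (\<lambda>x. (x, y))" by (intro continuous_intros)
  moreover have "(\<lambda>x. (x, y)) ` (Y - {y}) \<subseteq> {(x, y). x \<in> Y \<and> y \<in> Y \<and> x \<noteq> y}" using assms(2) by auto
  ultimately have "continuous_on (Y - {y}) (\<lambda>x. case (x, y) of (x, y) \<Rightarrow> K x y)"
    by (rule continuous_on_compose2)
  then show ?thesis by simp
qed

lemma kernel_class_continuous_right:
  assumes "K \<in> kernel_class s Y" "x \<in> Y"
  shows "continuous_on (Y - {x}) (K x)"
proof -
  have "continuous_on {(x, y). x \<in> Y \<and> y \<in> Y \<and> x \<noteq> y} (\<lambda>(x, y). K x y)"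
    using assms(1) by (simp add: kernel_class_def)
  moreover have "continuous_on (Y - {x}) (\<lambda>y. (x, y))" by (intro continuous_intros)
  moreover have "(\<lambda>y. (x, y)) ` (Y - {x}) \<subseteq> {(x, y). x \<in> Y \<and> y \<in> Y \<and> x \<noteq> y}" using assms(2) by auto
  ultimately have "continuous_on (Y - {x}) (\<lambda>y. case (x, y) of (x, y) \<Rightarrow> K x y)"
    by (rule continuous_on_compose2)
  then show ?thesis by simp
qed

lemma continuous_on_uniform_approx:
  fixes F :: "'a::metric_space \<Rightarrow> 'b::real_normed_vector"
  assumes "\<And>\<epsilon>. 0 < \<epsilon> \<Longrightarrow> \<exists>h. continuous_on S h \<and> (\<forall>x\<in>S. norm (F x - h x) \<le> \<epsilon>)"
  shows "continuous_on S F"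
proof -
  have "\<forall>n::nat. \<exists>h. continuous_on S h \<and> (\<forall>x\<in>S. norm (F x - h x) \<le> inverse (Suc n))"
    by (intro allI assms) simp
  then obtain h where h: "\<And>n::nat. continuous_on S (h n)"
    "\<And>n x. x \<in> S \<Longrightarrow> norm (F x - h n x) \<le> inverse (Suc n)" by metis
  have "uniform_limit S h F sequentially"
    unfolding uniform_limit_iff
  proof (intro allI impI)
    fix e :: real assume "0 < e"
    then have "eventually (\<lambda>n. inverse (real (Suc n)) < e) sequentially"
      using order_tendstoD(2)[OF LIMSEQ_inverse_real_of_nat] by blast
    then show "\<forall>\<^sub>F n in sequentially. \<forall>x\<in>S. dist (h n x) (F x) < e"
    proof eventually_elim
      case (elim n)
      then show ?case using h(2)[of _ n] by (force simp: dist_norm norm_minus_commute)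
    qed
  qed
  then show ?thesis using h(1) by (intro uniform_limit_theorem[where f = h and F = sequentially]) auto
qed

section \<open>Potentials and their continuity for bounded densities\<close>

context ahlfors_regular_measure begin

text \<open>Serves before convergence of the integral is known: where the integrand is not
  integrable, \<open>int_op\<close> has the default value 0 and the estimate is trivial.\<close>

lemma norm_int_op_le:
  assumes K: "\<And>x y. x \<in> Y \<Longrightarrow> y \<in> Y \<Longrightarrow> x \<noteq> y \<Longrightarrow> norm (K x y) \<le> C * dist x y powr - s"
    and C: "0 \<le> C" and x: "x \<in> Y" and mu[measurable]: "mu \<in> borel_measurable nu"
  shows "ennreal (norm (int_op nu K mu x))
    \<le> ennreal C * (\<integral>\<^sup>+y. ennreal (norm (mu y)) * ennreal (dist x y powr - s) \<partial>nu)"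
proof (cases "integrable nu (\<lambda>y. K x y * mu y)")
  case True
  have "ennreal (norm (int_op nu K mu x)) \<le> (\<integral>\<^sup>+y. ennreal (norm (K x y * mu y)) \<partial>nu)"
    unfolding int_op_def using True by (rule integral_norm_bound_ennreal)
  also have "\<dots> \<le> (\<integral>\<^sup>+y. ennreal C * (ennreal (norm (mu y)) * ennreal (dist x y powr - s)) \<partial>nu)"
  proof (rule nn_integral_mono_AE)
    show "AE y in nu. ennreal (norm (K x y * mu y)) \<le> ennreal C * (ennreal (norm (mu y)) * ennreal (dist x y powr - s))"
      using AE_neq_point[OF x] AE_space
    proof eventually_elim
      case (elim y)
      then have "norm (K x y) \<le> C * dist x y powr - s" using K x by (auto simp: space_eq)
      then have "norm (K x y) * norm (mu y) \<le> (C * dist x y powr - s) * norm (mu y)"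
        by (intro mult_right_mono) auto
      then show ?case using C by (simp add: norm_mult ennreal_mult[symmetric] ac_simps ennreal_leI)
    qed
  qed
  also have "\<dots> = ennreal C * (\<integral>\<^sup>+y. ennreal (norm (mu y)) * ennreal (dist x y powr - s) \<partial>nu)"
    by (rule nn_integral_cmult) measurable
  finally show ?thesis .
next
  case False
  then show ?thesis by (simp add: int_op_def not_integrable_integral_eq)
qed

text \<open>Boundedness follows from the uniform bound on the integral of the singular kernel. For
  continuity the kernel is cut off continuously near the diagonal: the truncated potentials are
  continuous by dominated convergence and approximate the full one uniformly, since the local kernel
  has small integral uniformly in \<open>x\<close>.\<close>

lemma int_op_continuous_bounded:
  assumes s: "0 \<le> s" "s < ups" and K: "K \<in> kernel_class s Y"
    and mu[measurable]: "mu \<in> borel_measurable nu"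
    and B: "0 \<le> B" "AE y in nu. norm (mu y) \<le> B"
  shows "continuous_on Y (int_op nu K mu)" "bounded (int_op nu K mu ` Y)"
proof -
  obtain C where C: "0 \<le> C"
    and KC: "\<And>x y. x \<in> Y \<Longrightarrow> y \<in> Y \<Longrightarrow> x \<noteq> y \<Longrightarrow> norm (K x y) \<le> C * dist x y powr - s"
    using kernel_class_bound[OF K] by blast
  obtain R where R: "0 \<le> R" "\<And>x. x \<in> Y \<Longrightarrow> (\<integral>\<^sup>+y. ennreal (dist x y powr - s) \<partial>nu) \<le> ennreal R"
    using nn_integral_dist_powr_bounded[OF s] by blast
  have Km[measurable]: "K x \<in> borel_measurable nu" if "x \<in> Y" for x
    using kernel_class_continuous_right[OF K that] by (rule continuous_on_measurable_nu)
  have Kmu: "AE y in nu. norm (K x y * mu y) \<le> C * B * dist x y powr - s" if x: "x \<in> Y" for x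
    using AE_neq_point[OF x] AE_space B(2)
  proof eventually_elim
    case (elim y)
    then have "norm (K x y) * norm (mu y) \<le> (C * dist x y powr - s) * B"
      using KC x C by (intro mult_mono) (auto simp: space_eq)
    then show ?case by (simp add: norm_mult ac_simps)
  qed
  have bound: "(\<integral>\<^sup>+y. ennreal (norm (K x y * mu y)) \<partial>nu) \<le> ennreal (C * B * R)" if x: "x \<in> Y" for x
  proof -
    have "(\<integral>\<^sup>+y. ennreal (norm (K x y * mu y)) \<partial>nu) \<le> (\<integral>\<^sup>+y. ennreal (C * B) * ennreal (dist x y powr - s) \<partial>nu)"
      using Kmu[OF x] B C
      by (intro nn_integral_mono_AE) (auto simp: ennreal_mult[symmetric] ennreal_leI elim: AE_mp)
    also have "\<dots> = ennreal (C * B) * (\<integral>\<^sup>+y. ennreal (dist x y powr - s) \<partial>nu)"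
      by (rule nn_integral_cmult) measurable
    also have "\<dots> \<le> ennreal (C * B) * ennreal R" by (intro mult_left_mono R x) simp
    also have "\<dots> = ennreal (C * B * R)" using B C R by (simp add: ennreal_mult)
    finally show ?thesis .
  qed
  have int: "integrable nu (\<lambda>y. K x y * mu y)" if x: "x \<in> Y" for x
    using x le_less_trans[OF bound[OF x] ennreal_less_top] by (intro integrableI_bounded) auto
  have "norm (int_op nu K mu x) \<le> C * B * R" if x: "x \<in> Y" for x
  proof -
    have "ennreal (norm (int_op nu K mu x)) \<le> ennreal (C * B * R)"
      unfolding int_op_def by (rule order_trans[OF integral_norm_bound_ennreal[OF int[OF x]] bound[OF x]])
    then show ?thesis using B C R by (simp add: ennreal_le_iff)
  qed
  then show "bounded (int_op nu K mu ` Y)" by (auto simp: bounded_iff)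
  show "continuous_on Y (int_op nu K mu)"
  proof (rule continuous_on_uniform_approx)
    fix \<epsilon> :: real assume \<epsilon>: "0 < \<epsilon>"
    define \<eta> where "\<eta> = \<epsilon> / (C * B + 1)"
    have CB: "0 \<le> C * B" using C B by simp
    have \<eta>: "0 < \<eta>" "C * B * \<eta> \<le> \<epsilon>" using \<epsilon> CB
      by (auto simp: \<eta>_def field_simps intro!: divide_pos_pos add_nonneg_pos)
    obtain \<delta> where \<delta>: "0 < \<delta>"
      and row: "\<And>x. x \<in> Y \<Longrightarrow> (\<integral>\<^sup>+y. ennreal (dist x y powr - s) * indicator (ball x \<delta>) y \<partial>nu) \<le> ennreal \<eta>"
      using local_kernel_small[OF s \<eta>(1)] by metis
    \<comment> \<open>Piecewise linear cut-off: 0 up to \<open>\<delta> / 2\<close>, 1 from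
      \<open>\<delta>\<close> on.\<close>
    define \<phi> where "\<phi> t = min 1 (max 0 (2 * t / \<delta> - 1))" for t
    have \<phi>: "0 \<le> \<phi> t" "\<phi> t \<le> 1" for t by (auto simp: \<phi>_def)
    have \<phi>0: "\<phi> t = 0" if "t \<le> \<delta> / 2" for t using that \<delta> by (auto simp: \<phi>_def field_simps)
    have \<phi>1: "\<phi> t = 1" if "\<delta> \<le> t" for t using that \<delta> by (auto simp: \<phi>_def field_simps)
    have \<phi>c: "continuous_on A \<phi>" for A unfolding \<phi>_def using \<delta> by (intro continuous_intros) auto
    define f where "f x y = \<phi> (dist x y) *\<^sub>R (K x y * mu y)" for x y
    have [measurable]: "(\<lambda>y. \<phi> (dist x y)) \<in> borel_measurable nu" for x
      by (rule continuous_on_measurable_nu[where x = x])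
        (intro continuous_on_compose2[OF \<phi>c[of UNIV]] continuous_intros, simp)
    have fm[measurable]: "f x \<in> borel_measurable nu" if "x \<in> Y" for x
      unfolding f_def using that by measurable
    have fle: "norm (f x y) \<le> norm (K x y * mu y)" for x y
      using \<phi>[of "dist x y"] by (simp add: f_def mult_left_le_one_le)
    have fint: "integrable nu (f x)" if "x \<in> Y" for x
      using int[OF that] fm[OF that] by (rule Bochner_Integration.integrable_bound) (use fle in auto)
    define h where "h x = (\<integral>y. f x y \<partial>nu)" for x
    \<comment> \<open>The error integrand vanishes outside \<open>ball x \<delta>\<close> and is
      dominated almost everywhere inside it by \<open>C * B\<close> times the local kernel.\<close>
    have "norm (int_op nu K mu x - h x) \<le> \<epsilon>" if x: "x \<in> Y" for x
    proof -
      have "int_op nu K mu x - h x = (\<integral>y. K x y * mu y - f x y \<partial>nu)"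
        unfolding int_op_def h_def using int fint x by simp
      then have "ennreal (norm (int_op nu K mu x - h x)) \<le> (\<integral>\<^sup>+y. ennreal (norm (K x y * mu y - f x y)) \<partial>nu)"
        using int fint x by (simp only:) (intro integral_norm_bound_ennreal Bochner_Integration.integrable_diff)
      also have "\<dots> \<le> (\<integral>\<^sup>+y. ennreal (C * B) * (ennreal (dist x y powr - s) * indicator (ball x \<delta>) y) \<partial>nu)"
      proof (rule nn_integral_mono_AE)
        show "AE y in nu. ennreal (norm (K x y * mu y - f x y))
          \<le> ennreal (C * B) * (ennreal (dist x y powr - s) * indicator (ball x \<delta>) y)"
          using Kmu[OF x]
        proof eventually_elim
          case (elim y)
          have eq: "K x y * mu y - f x y = (1 - \<phi> (dist x y)) *\<^sub>R (K x y * mu y)"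
            by (simp add: f_def scaleR_diff_left)
          show ?case
          proof (cases "dist x y < \<delta>")
            case True
            have "norm (K x y * mu y - f x y) \<le> norm (K x y * mu y)"
              unfolding eq using \<phi>[of "dist x y"] by (simp add: mult_left_le_one_le)
            also note elim
            finally show ?thesis using True CB by (simp add: ennreal_mult[symmetric] ennreal_leI)
          next
            case False
            then show ?thesis using \<phi>1 by (simp add: eq)
          qed
        qed
      qed
      also have "\<dots> = ennreal (C * B) * (\<integral>\<^sup>+y. ennreal (dist x y powr - s) * indicator (ball x \<delta>) y \<partial>nu)"
        by (rule nn_integral_cmult) measurable
      also have "\<dots> \<le> ennreal (C * B) * ennreal \<eta>" by (intro mult_left_mono row x) simp
      also have "\<dots> = ennreal (C * B * \<eta>)" using CB \<eta> by (simp add: ennreal_mult)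
      also have "\<dots> \<le> ennreal \<epsilon>" using \<eta> by (intro ennreal_leI)
      finally show ?thesis using \<epsilon> by (simp add: ennreal_le_iff)
    qed
    moreover have "continuous_on Y h"
      unfolding continuous_on_sequentially
    proof (intro allI ballI impI)
      fix X x assume x: "x \<in> Y" and "(\<forall>n. X n \<in> Y) \<and> X \<longlonglongrightarrow> x"
      then have X: "\<And>n. X n \<in> Y" "X \<longlonglongrightarrow> x" by auto
      have "(\<lambda>n. \<integral>y. f (X n) y \<partial>nu) \<longlonglongrightarrow> (\<integral>y. f x y \<partial>nu)"
      proof (rule integral_dominated_convergence)
        show "f x \<in> borel_measurable nu" "\<And>n. f (X n) \<in> borel_measurable nu"
          using x X by (auto intro: fm)
        \<comment> \<open>A constant dominates because the cut-off removes distances up to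
          \<open>\<delta> / 2\<close>; it is integrable since \<open>nu\<close> is finite.\<close>
        show "integrable nu (\<lambda>_. C * B * (\<delta> / 2) powr - s)" by simp
        show "AE y in nu. norm (f (X n) y) \<le> C * B * (\<delta> / 2) powr - s" for n
          using Kmu[OF X(1)[of n]]
        proof eventually_elim
          case (elim y)
          show ?case
          proof (cases "dist (X n) y \<le> \<delta> / 2")
            case True
            then show ?thesis using CB by (simp add: f_def \<phi>0)
          next
            case False
            have "norm (f (X n) y) \<le> C * B * dist (X n) y powr - s" using fle elim by (rule order_trans)
            also have "\<dots> \<le> C * B * (\<delta> / 2) powr - s"
              using CB False \<delta> s by (intro mult_left_mono powr_mono2') auto
            finally show ?thesis .
          qed
        qed
        show "AE y in nu. (\<lambda>n. f (X n) y) \<longlonglongrightarrow> f x y"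
          using AE_neq_point[OF x] AE_space
        proof eventually_elim
          case (elim y)
          then have y: "y \<in> Y" "x \<noteq> y" by (auto simp: space_eq)
          \<comment> \<open>\<open>K\<close> is continuous in its first argument only away from
            \<open>y\<close>, so the sequence must eventually avoid \<open>y\<close>.\<close>
          have "eventually (\<lambda>n. X n \<in> - {y}) sequentially"
            using X(2) y(2) by (intro topological_tendstoD) auto
          then have ev: "eventually (\<lambda>n. X n \<in> Y - {y}) sequentially"
            by eventually_elim (use X(1) in auto)
          have "(\<lambda>n. K (X n) y) \<longlonglongrightarrow> K x y"
            using continuous_on_tendsto_compose[OF kernel_class_continuous_left[OF K y(1)] X(2) _ ev] x y(2) by simp
          moreover have "(\<lambda>n. \<phi> (dist (X n) y)) \<longlonglongrightarrow> \<phi> (dist x y)"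
            by (rule continuous_on_tendsto_compose[OF \<phi>c[of UNIV]]) (auto intro!: tendsto_intros X)
          ultimately show ?case unfolding f_def by (intro tendsto_intros)
        qed
      qed
      then show "(h \<circ> X) \<longlonglongrightarrow> h x" by (simp add: h_def o_def)
    qed
    ultimately show "\<exists>h. continuous_on Y h \<and> (\<forall>x\<in>Y. norm (int_op nu K mu x - h x) \<le> \<epsilon>)" by blast
  qed
qed

end

section \<open>The bounded continuous representative of the solution\<close>

theorem theorem5p1:
  fixes Y :: "'a::metric_space set"
    and nu :: "'a measure"
    and ups s :: real
    and K :: "'a \<Rightarrow> 'a \<Rightarrow> complex"
    and g mu :: "'a \<Rightarrow> complex"
  assumes "bounded Y"
    and "space nu = Y"
    and "sets (restrict_space borel Y) \<subseteq> sets nu"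
    and "\<And>x r. x \<in> Y \<Longrightarrow> 0 < r \<Longrightarrow> emeasure nu (ball x r \<inter> Y) < \<infinity>"
    and "0 < ups" and "0 \<le> s" and "s < ups"
    and "upper_ahlfors_regular nu ups Y"
    and "K \<in> kernel_class s Y"
    and "continuous_on Y g" and "bounded (g ` Y)"
    and "mu \<in> L2 nu"
    and "AE x in nu. mu x - int_op nu K mu x = g x"
  shows "\<exists>f. continuous_on Y f \<and> bounded (f ` Y) \<and> (AE x in nu. mu x = f x)"
proof -
  \<comment> \<open>A bounded nonempty \<open>Y\<close> lies in one ball centred at a point of
    \<open>Y\<close>, and such balls have finite measure.\<close>
  have "emeasure nu Y < \<infinity>"
  proof (cases "Y = {}")
    case False
    then obtain x where x: "x \<in> Y" by blast
    obtain r where "0 < r" "Y \<subseteq> ball x r"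
      using bounded_subset_ballD[OF \<open>bounded Y\<close>] by blast
    then show ?thesis using assms(4)[OF x, of r] by (simp add: Int_absorb1)
  qed simp
  then interpret finite_measure nu using assms(2) by (intro finite_measureI) auto
  obtain r0 c where r0: "0 < r0" and c: "0 < c"
    and reg: "\<And>x r. x \<in> Y \<Longrightarrow> 0 < r \<Longrightarrow> ereal r < r0 \<Longrightarrow> emeasure nu (ball x r \<inter> Y) \<le> ennreal (c * r powr ups)"
    using \<open>upper_ahlfors_regular nu ups Y\<close> unfolding upper_ahlfors_regular_def by blast
  \<comment> \<open>The radius \<open>r0\<close> is extended real and possibly infinite; the locale
    takes a real radius below it.\<close>
  obtain r1 where r1: "0 < r1" "ereal r1 < r0"
    using ereal_dense2[OF r0] by (auto simp: zero_ereal_def)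
  interpret ahlfors_regular_measure nu Y ups r1 c
  proof
    show "emeasure nu (ball x r \<inter> Y) \<le> ennreal (c * r powr ups)" if "x \<in> Y" "0 < r" "r < r1" for x r
      using that r1 by (intro reg) (auto intro: less_trans[of "ereal r" "ereal r1"])
  qed (use assms c r1 in auto)
  have mu[measurable]: "mu \<in> borel_measurable nu" and mu2: "integrable nu (\<lambda>x. (norm (mu x))\<^sup>2)"
    using \<open>mu \<in> L2 nu\<close> by (auto simp: L2_def)
  \<comment> \<open>On a finite measure space square integrability gives integrability, through
    \<open>t \<le> 1 + t\<^sup>2\<close>.\<close>
  have "integrable nu (\<lambda>x. norm (mu x))"
  proof (rule Bochner_Integration.integrable_bound)
    show "integrable nu (\<lambda>x. 1 + (norm (mu x))\<^sup>2)" using mu2 by simp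
    have "t \<le> 1 + t\<^sup>2" for t :: real using zero_le_power2[of "t - 1/2"] by (simp add: power2_eq_square algebra_simps)
    then show "AE x in nu. norm (norm (mu x)) \<le> norm (1 + (norm (mu x))\<^sup>2)" by simp
  qed simp
  then have fin: "(\<integral>\<^sup>+x. ennreal (norm (mu x)) \<partial>nu) < \<infinity>" by (simp add: integrable_iff_bounded)
  obtain C where C: "0 \<le> C"
    and KC: "\<And>x y. x \<in> Y \<Longrightarrow> y \<in> Y \<Longrightarrow> x \<noteq> y \<Longrightarrow> norm (K x y) \<le> C * dist x y powr - s"
    using kernel_class_bound[OF \<open>K \<in> kernel_class s Y\<close>] by blast
  obtain G where G: "\<And>x. x \<in> Y \<Longrightarrow> norm (g x) \<le> G"
    using \<open>bounded (g ` Y)\<close> by (auto simp: bounded_iff)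
  have "AE x in nu. ennreal (norm (mu x))
      \<le> ennreal G + ennreal C * (\<integral>\<^sup>+y. ennreal (norm (mu y)) * ennreal (dist x y powr - s) \<partial>nu)"
    using assms(13) AE_space
  proof eventually_elim
    case (elim x)
    then have x: "x \<in> Y" by (simp add: space_eq)
    have "mu x = g x + int_op nu K mu x" using elim by (simp add: algebra_simps)
    then have "norm (mu x) \<le> G + norm (int_op nu K mu x)"
      using norm_triangle_ineq[of "g x" "int_op nu K mu x"] G[OF x] by simp
    then have "ennreal (norm (mu x)) \<le> ennreal G + ennreal (norm (int_op nu K mu x))"
      \<comment> \<open>\<open>G\<close> is nonnegative because it bounds \<open>norm (g x)\<close>
        at this \<open>x\<close>; splitting the \<open>ennreal\<close> sum uses this.\<close>
      using order_trans[OF norm_ge_zero G[OF x]] by (simp add: ennreal_leI flip: ennreal_plus)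
    then show ?case using norm_int_op_le[OF KC C x mu] by (meson add_left_mono order_trans)
  qed
  then obtain B where B: "0 \<le> B" "AE x in nu. ennreal (norm (mu x)) \<le> ennreal B"
    using essentially_bounded_of_potential_bound[OF assms(6,7) C, of "\<lambda>x. ennreal (norm (mu x))" "ennreal G"] fin
    by auto
  then have "AE x in nu. norm (mu x) \<le> B" by (simp add: ennreal_le_iff)
  note A = int_op_continuous_bounded[OF assms(6,7,9) mu B(1) this]
  show ?thesis
  \<comment> \<open>The equation itself supplies the representative: its right-hand side
    \<open>g + A[K, mu]\<close> is defined at every point and is bounded and continuous on
    \<open>Y\<close>.\<close>
  proof (intro exI[of _ "\<lambda>x. g x + int_op nu K mu x"] conjI)
    show "continuous_on Y (\<lambda>x. g x + int_op nu K mu x)" using A assms(10) by (intro continuous_intros)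
    show "bounded ((\<lambda>x. g x + int_op nu K mu x) ` Y)" using A assms(11) by (intro bounded_plus_comp)
    show "AE x in nu. mu x = g x + int_op nu K mu x"
      using assms(13) by (rule AE_mp) (auto simp: algebra_simps intro!: AE_I2)
  qed
qed

end
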